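(* Let $\varphi:\mathbb{R}\to\mathbb{R}$ be the function given by $\varphi(t)=t-n$ if $t\in[n,n+\frac12]$ for some $n\in\mathbb{Z}$, and $\varphi(t)=n-t$ if $t\in[n-\frac12,n]$ for some $n\in\mathbb{Z}$. For every integer $n\ge 0$ let $\varphi_n(t)=2^{-n}\varphi(2^n t)$. For every integer $k\ge 1$ let $n_k=\lfloor \log_2\log_2(k+1)\rfloor$ and $$M_k=\Big\{\big(t,\tfrac1k\varphi_{n_k}(t)\big): t\in[0,1]\Big\}\subset\mathbb{R}^2 .$$ Let $I=[0,1]\times\{0\}\subset\mathbb{R}^2$. Then the space $$M=I\cup\bigcup_{k=1}^{\infty}M_k,$$ with the topology inherited from the plane $\mathbb{R}^2$, is a topological IFS-attractor.
   Context: A compact topological space $X$ is called a topological IFS-attractor if there are finitely many continuous maps $f_1,\dots,f_n:X\to X$ such that $X=\bigcup_{i=1}^n f_i(X)$ and, for every open cover $\mathcal{U}$ of $X$, there is a positive integer $m$ such that for any maps $g_1,\dots,g_m\in\{f_1,\dots,f_n\}$ the set $g_1\circ\dots\circ g_m(X)$ is contained in some set $U\in\mathcal{U}$. Here $\lfloor x\rfloor$ denotes the integer part of $x$. *)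

theory Defs
  imports "HOL-Analysis.Analysis"
begin

text \<open>
  The maps are total functions on the ambient type of which only the behaviour on
  \<^term>\<open>topspace X\<close> matters; the list \<^term>\<open>[g\<^sub>1, g\<^sub>2]\<close> stands for the
  composition of \<open>g\<^sub>1\<close> after \<open>g\<^sub>2\<close>.
\<close>

definition topological_IFS_attractor :: "'a topology \<Rightarrow> bool" where
  "topological_IFS_attractor X \<longleftrightarrow>
     compact_space X \<and>
     (\<exists>F :: ('a \<Rightarrow> 'a) set.
        finite F \<and>
        (\<forall>f\<in>F. continuous_map X X f) \<and>
        topspace X = (\<Union>f\<in>F. f ` topspace X) \<and>
        (\<forall>\<U>. (\<forall>U\<in>\<U>. openin X U) \<and> \<Union>\<U> = topspace X \<longrightarrow>
           (\<exists>m>0. \<forall>gs. length gs = m \<and> set gs \<subseteq> F \<longrightarrow>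
              (\<exists>U\<in>\<U>. foldr (\<circ>) gs id ` topspace X \<subseteq> U))))"

definition tooth :: "real \<Rightarrow> real" where
  "tooth t = (if t \<le> of_int \<lfloor>t\<rfloor> + 1/2 then t - of_int \<lfloor>t\<rfloor> else of_int \<lceil>t\<rceil> - t)"

lemma tooth_up:
  fixes n :: int
  assumes "t \<in> {of_int n .. of_int n + 1/2}"
  shows "tooth t = t - of_int n"
proof -
  have "\<lfloor>t\<rfloor> = n"
    using assms by (intro floor_unique) auto
  then show ?thesis
    using assms by (simp add: tooth_def)
qed

lemma tooth_down:
  fixes n :: int
  assumes "t \<in> {of_int n - 1/2 .. of_int n}"
  shows "tooth t = of_int n - t"
proof (cases "t = of_int n")
  case True
  then show ?thesis by (simp add: tooth_def)
next
  case False
  then have "\<lfloor>t\<rfloor> = n - 1"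
    using assms by (intro floor_unique) auto
  moreover have "\<lceil>t\<rceil> = n"
    using assms by (intro ceiling_unique) auto
  ultimately show ?thesis
    using assms by (auto simp: tooth_def)
qed

definition scaled_tooth :: "nat \<Rightarrow> real \<Rightarrow> real" where
  "scaled_tooth n t = tooth (2 ^ n * t) / 2 ^ n"

definition level :: "nat \<Rightarrow> nat" where
  "level k = nat \<lfloor>log 2 (log 2 (real k + 1))\<rfloor>"

lemma int_level:
  assumes "k \<ge> 1"
  shows "int (level k) = \<lfloor>log 2 (log 2 (real k + 1))\<rfloor>"
proof -
  have "log 2 (real k + 1) \<ge> 1"
    using assms by simp
  then have "log 2 (log 2 (real k + 1)) \<ge> 0"
    by simp
  then show ?thesis
    by (simp add: level_def)
qed

definition teeth_row :: "nat \<Rightarrow> (real \<times> real) set" where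
  "teeth_row k = (\<lambda>t. (t, 1 / real k * scaled_tooth (level k) t)) ` {0..1}"

definition shark_teeth :: "(real \<times> real) set" where
  "shark_teeth = {0..1} \<times> {0} \<union> (\<Union>k\<in>{1..}. teeth_row k)"

end

theory Submission
  imports Defs
begin

text \<open>
  The first row is a single tooth, the only part of the space higher than 1/4. Let \<open>q\<close> map the
  space onto \<open>[0,1]\<close> by \<open>q (x, y) = max 0 (4 * y - 1)\<close>, and let \<open>F\<close> consist of the maps \<open>h \<circ> q\<close>,
  where \<open>h\<close> runs over eight short pieces of the first row and over one path \<open>P\<close> onto the rest of
  the space. Then \<open>q \<circ> h\<close> contracts \<open>[0,1]\<close> by 1/2 (it is constant if \<open>h = P\<close>), so long
  compositions have small images. The path \<open>P\<close> traverses a dyadic interval with all the finer teeth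
  over it: first a loop at the left endpoint through the interval and the teeth spanning it, then
  the left half, then the right half, recursively.
\<close>

section \<open>Attractors from maps that factor through an interval\<close>

text \<open>The contraction happens in \<open>{0..1}\<close>, not in \<open>S\<close>. Each letter
  is some \<open>h \<circ> q\<close>, and \<open>q \<circ> h\<close> halves distances, so
  \<open>q\<close> after a long word has small image. The outermost \<open>h\<close> is uniformly
  continuous and turns this into a small image in \<open>S\<close>, which by a Lebesgue number
  argument fits into one member of the cover.\<close>

lemma attractor_through_interval:
  fixes S :: "'a::metric_space set" and q :: "'a \<Rightarrow> real" and H :: "(real \<Rightarrow> 'a) set"
  assumes H: "finite H" "\<And>h. h \<in> H \<Longrightarrow> continuous_on {0..1} h" "(\<Union>h\<in>H. h ` {0..1}) = S"
    and q: "continuous_on S q" "q ` S = {0..1}"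
    and contr: "\<And>h s t. h \<in> H \<Longrightarrow> s \<in> {0..1} \<Longrightarrow> t \<in> {0..1} \<Longrightarrow>
                  dist (q (h s)) (q (h t)) \<le> dist s t / 2"
  shows "topological_IFS_attractor (top_of_set S)"
proof -
  have "compact S"
    unfolding H(3)[symmetric] using H(1,2)
    by (intro compact_UN compact_continuous_image compact_Icc) auto
  define F where "F = (\<lambda>h. h \<circ> q) ` H"
  have FS: "f ` S \<subseteq> S" if "f \<in> F" for f
    using that H(3) q(2) unfolding F_def by fastforce
  have step: "dist (q (f x)) (q (f y)) \<le> dist (q x) (q y) / 2"
    if f: "f \<in> F" and xy: "x \<in> S" "y \<in> S" for f x y
  proof -
    obtain h where "h \<in> H" "f = h \<circ> q"
      using f unfolding F_def by blast
    moreover have "q x \<in> {0..1}" "q y \<in> {0..1}"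
      using xy q(2) by blast+
    ultimately show ?thesis
      using contr by simp
  qed
  have word: "foldr (\<circ>) gs id x \<in> S \<and>
      dist (q (foldr (\<circ>) gs id x)) (q (foldr (\<circ>) gs id y)) \<le> (1/2) ^ length gs * dist (q x) (q y)"
    if "set gs \<subseteq> F" "x \<in> S" "y \<in> S" for gs x y
    using that
  proof (induction gs arbitrary: x y)
    case (Cons g gs)
    let ?w = "foldr (\<circ>) gs id"
    have g: "g \<in> F" and gs: "set gs \<subseteq> F" using Cons.prems(1) by simp_all
    have w: "?w x \<in> S" "?w y \<in> S" "dist (q (?w x)) (q (?w y)) \<le> (1/2) ^ length gs * dist (q x) (q y)"
      using Cons.IH[OF gs Cons.prems(2,3)] Cons.IH[OF gs Cons.prems(3,2)] by blast+
    have "g (?w x) \<in> S" using FS[OF g] w(1) by blast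
    moreover have "dist (q (g (?w x))) (q (g (?w y))) \<le> (1/2) ^ length (g # gs) * dist (q x) (q y)"
      using step[OF g w(1,2)] w(3) unfolding length_Cons power_Suc by linarith
    ultimately show ?case
      unfolding foldr_Cons o_apply by (rule conjI)
  qed auto
  have "\<exists>m>0. \<forall>gs. length gs = m \<and> set gs \<subseteq> F \<longrightarrow> (\<exists>U\<in>\<U>. foldr (\<circ>) gs id ` S \<subseteq> U)"
    if op: "\<forall>U\<in>\<U>. openin (top_of_set S) U" and cover: "\<Union>\<U> = S" for \<U>
  proof -
    \<comment> \<open>The members of the cover are open only relative to \<open>S\<close>; the
      Lebesgue number lemma needs open sets of the ambient space.\<close>
    define \<G> where "\<G> = {G. open G \<and> S \<inter> G \<in> \<U>}"
    have "S \<subseteq> \<Union>\<G>"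
    proof
      fix x assume "x \<in> S"
      then obtain U where "U \<in> \<U>" "x \<in> U" using cover by blast
      moreover obtain G where "open G" "U = S \<inter> G"
        using op \<open>U \<in> \<U>\<close> by (auto simp: openin_open)
      ultimately show "x \<in> \<Union>\<G>" by (auto simp: \<G>_def)
    qed
    moreover have "open G" if "G \<in> \<G>" for G
      using that by (simp add: \<G>_def)
    ultimately obtain e where e: "0 < e" "\<And>x. x \<in> S \<Longrightarrow> \<exists>G\<in>\<G>. ball x e \<subseteq> G"
      using Heine_Borel_lemma[OF \<open>compact S\<close>] by metis
    have "\<exists>d>0. \<forall>s\<in>{0..1}. \<forall>t\<in>{0..1}. dist s t < d \<longrightarrow> dist (h s) (h t) < e" if "h \<in> H" for h
      using compact_uniformly_continuous[OF H(2)[OF that]] e(1)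
      unfolding uniformly_continuous_on_def by (metis compact_Icc dist_commute)
    then obtain d where d: "\<And>h. h \<in> H \<Longrightarrow> 0 < d h"
      "\<And>h s t. h \<in> H \<Longrightarrow> s \<in> {0..1} \<Longrightarrow> t \<in> {0..1} \<Longrightarrow> dist s t < d h \<Longrightarrow> dist (h s) (h t) < e"
      by metis
    \<comment> \<open>Inserting 1 makes the set visibly nonempty, so that \<open>Min\<close> is
      meaningful.\<close>
    have "0 < Min (insert 1 (d ` H))"
      using H(1) d(1) by auto
    then obtain m where m: "(1/2) ^ m < Min (insert 1 (d ` H))"
      using real_arch_pow_inv[of _ "1/2"] by auto
    \<comment> \<open>Words of length \<open>Suc m\<close>: the \<open>m\<close> inner letters
      shrink the \<open>q\<close>-image below every \<open>d h\<close>, and the outermost letter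
      \<open>h \<circ> q\<close> applies the modulus of continuity of \<open>h\<close>.\<close>
    have "\<exists>U\<in>\<U>. foldr (\<circ>) gs id ` S \<subseteq> U" if gs: "length gs = Suc m" "set gs \<subseteq> F" for gs
    proof -
      obtain h gs' where gs': "gs = (h \<circ> q) # gs'" "h \<in> H" "length gs' = m" "set gs' \<subseteq> F"
        using gs by (cases gs) (auto simp: F_def)
      have inS: "foldr (\<circ>) gs id x \<in> S" if "x \<in> S" for x
        using word gs that by blast
      have close: "dist (foldr (\<circ>) gs id x) (foldr (\<circ>) gs id y) < e" if xy: "x \<in> S" "y \<in> S" for x y
      proof -
        let ?x = "foldr (\<circ>) gs' id x" and ?y = "foldr (\<circ>) gs' id y"
        have S': "q ?x \<in> {0..1}" "q ?y \<in> {0..1}"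
          using word[OF gs'(4)] xy q(2) by blast+
        have "q x \<in> {0..1}" "q y \<in> {0..1}"
          using xy q(2) by blast+
        then have "dist (q x) (q y) \<le> 1"
          by (auto simp: dist_real_def abs_le_iff)
        then have "(1/2) ^ m * dist (q x) (q y) \<le> (1/2) ^ m"
          by (intro mult_left_le) auto
        then have "dist (q ?x) (q ?y) \<le> (1/2) ^ m"
          using word[OF gs'(4) xy] unfolding gs'(3) by (blast intro: order_trans)
        also have "\<dots> < d h"
          using m H(1) gs'(2) by auto
        finally show ?thesis
          using d(2)[OF gs'(2) S'] by (simp add: gs'(1))
      qed
      obtain x where x: "x \<in> S"
        using q(2) by fastforce
      obtain G where "G \<in> \<G>" "ball (foldr (\<circ>) gs id x) e \<subseteq> G"
        using e(2) inS x by blast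
      then show ?thesis
        using close[OF x] inS by (intro bexI[of _ "S \<inter> G"]) (auto simp: \<G>_def subset_iff)
    qed
    then show ?thesis by blast
  qed
  moreover have "continuous_on S f" if "f \<in> F" for f
    using that H(2) q by (auto simp: F_def intro!: continuous_on_compose)
  moreover have "(\<Union>f\<in>F. f ` S) = (\<Union>h\<in>H. h ` q ` S)"
    by (auto simp: F_def)
  then have "(\<Union>f\<in>F. f ` S) = S"
    unfolding q(2) H(3) .
  moreover have "finite F"
    using H(1) by (simp add: F_def)
  ultimately show ?thesis
    unfolding topological_IFS_attractor_def using \<open>compact S\<close> FS
    by (intro conjI exI[of _ F]) (simp_all add: compact_space_subtopology image_subset_iff_funcset)
qed

section \<open>Traversing a dyadic tree of loops\<close>

text \<open>Each path is run out and back, and the resulting loops at \<open>a\<close> are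
  concatenated. The constant path serves the empty family, whence \<open>insert a\<close>.\<close>

lemma loop_through_paths:
  assumes "finite A" "\<And>i. i \<in> A \<Longrightarrow> path (g i) \<and> pathstart (g i) = a"
  shows "\<exists>p. path p \<and> pathstart p = a \<and> pathfinish p = a \<and>
             path_image p = insert a (\<Union>i\<in>A. path_image (g i))"
  using assms
proof (induction A rule: finite_induct)
  case empty
  then show ?case
    by (intro exI[of _ "\<lambda>_. a"]) (auto simp: path_def pathstart_def pathfinish_def path_image_def)
next
  case (insert i A)
  then obtain p where "path p" "pathstart p = a" "pathfinish p = a"
      "path_image p = insert a (\<Union>i\<in>A. path_image (g i))"
    by auto
  moreover have "path (g i)" "pathstart (g i) = a"
    using insert.prems by auto
  moreover have "a \<in> path_image (g i)"
    using calculation(6) pathstart_in_path_image by metis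
  ultimately show ?case
    by (intro exI[of _ "(g i +++ reversepath (g i)) +++ p"]) (auto simp: path_image_join)
qed

text \<open>A binary tree whose cell \<open>(n, j)\<close> has children
  \<open>(Suc n, 2 * j)\<close> and \<open>(Suc n, Suc (2 * j))\<close>. Its left endpoint is
  \<open>v n j\<close>, the loop \<open>L n j\<close> is attached there, and \<open>B n j\<close> is
  a region that contains everything drawn over the cell and its descendants.\<close>

locale dyadic_loops =
  fixes v :: "nat \<Rightarrow> nat \<Rightarrow> 'a::banach" and B :: "nat \<Rightarrow> nat \<Rightarrow> 'a set"
    and L :: "nat \<Rightarrow> nat \<Rightarrow> real \<Rightarrow> 'a" and c :: real
  assumes v_refine: "v (Suc n) (2 * j) = v n j"
    and L: "path (L n j)" "pathstart (L n j) = v n j" "pathfinish (L n j) = v n j"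
      "path_image (L n j) \<subseteq> B n j"
    and segment: "closed_segment (v n j) (v n (Suc j)) \<subseteq> B n j"
    and B_refine: "B (Suc n) (2 * j) \<subseteq> B n j" "B (Suc n) (Suc (2 * j)) \<subseteq> B n j"
    and B_small: "x \<in> B n j \<Longrightarrow> y \<in> B n j \<Longrightarrow> dist x y \<le> c / 2 ^ n"
begin

text \<open>Here \<open>m\<close> counts the generations of loops: \<open>trav m n j\<close> runs
  through the loops at depths \<open>n\<close> to \<open>n + m - 1\<close> below the cell and joins
  the vertices at depth \<open>n + m\<close> by segments.\<close>

fun trav :: "nat \<Rightarrow> nat \<Rightarrow> nat \<Rightarrow> real \<Rightarrow> 'a" where
  "trav 0 n j = linepath (v n j) (v n (Suc j))"
| "trav (Suc m) n j = L n j +++ trav m (Suc n) (2 * j) +++ trav m (Suc n) (Suc (2 * j))"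

lemma v_refine': "v (Suc n) (Suc (Suc (2 * j))) = v n (Suc j)"
  using v_refine[of n "Suc j"] by simp

lemma trav_ends: "pathstart (trav m n j) = v n j" "pathfinish (trav m n j) = v n (Suc j)"
  by (induction m arbitrary: n j) (auto simp: L v_refine')

lemma path_trav: "path (trav m n j)"
  by (induction m arbitrary: n j) (auto simp: L trav_ends v_refine)

lemma path_image_trav_Suc:
  "path_image (trav (Suc m) n j) =
     path_image (L n j) \<union> path_image (trav m (Suc n) (2 * j)) \<union> path_image (trav m (Suc n) (Suc (2 * j)))"
  by (auto simp: path_image_join L trav_ends v_refine)

lemma trav_in_B: "path_image (trav m n j) \<subseteq> B n j"
proof (induction m arbitrary: n j)
  case (Suc m)
  show ?case
    unfolding path_image_trav_Suc using L(4) B_refine Suc.IH by blast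
qed (simp add: segment)

lemma trav_in_B': "t \<in> {0..1} \<Longrightarrow> trav m n j t \<in> B n j"
  using trav_in_B[of m n j] unfolding path_image_def by blast

lemma c_nonneg: "c \<ge> 0"
  using B_small[of "v 0 0" 0 0 "v 0 0"] segment[of 0 0] by auto

text \<open>Both traversals divide the parameter interval alike and differ only while they are over
  a cell of depth \<open>n + m\<close>; there both stay in the region \<open>B\<close> of that
  cell.\<close>

lemma dist_trav_Suc: "t \<in> {0..1} \<Longrightarrow> dist (trav (Suc m) n j t) (trav m n j t) \<le> c / 2 ^ (n + m)"
proof (induction m arbitrary: n j t)
  case 0
  then show ?case
    using B_small trav_in_B' by (metis add.right_neutral)
next
  case (Suc m)
  \<comment> \<open>The pieces of \<open>{0..1}\<close> that \<open>+++\<close> assigns to the loop,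
    the left child and the right child.\<close>
  consider "t \<le> 1/2" | "t > 1/2" "2 * t - 1 \<le> 1/2" | "2 * t - 1 > 1/2" by linarith
  then show ?case
  proof cases
    case 1
    then show ?thesis using c_nonneg by (simp add: joinpaths_def)
  next
    case 2
    then show ?thesis
      using Suc.IH[of "2 * (2 * t - 1)" "Suc n" "2 * j"] Suc.prems
      by (subst (1 2) trav.simps(2)) (simp add: joinpaths_def del: trav.simps)
  next
    case 3
    then show ?thesis
      using Suc.IH[of "2 * (2 * t - 1) - 1" "Suc n" "Suc (2 * j)"] Suc.prems
      by (subst (1 2) trav.simps(2)) (simp add: joinpaths_def del: trav.simps)
  qed
qed

text \<open>Consecutive traversals differ by a geometric bound, so they converge uniformly to a
  path. A point met by all late traversals is a limit of points of the limit path, whose image is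
  closed.\<close>

lemma limit_path:
  obtains P where "path P" "path_image P \<subseteq> closure (B 0 0)"
    "\<And>x m0. (\<And>m. m \<ge> m0 \<Longrightarrow> x \<in> path_image (trav m 0 0)) \<Longrightarrow> x \<in> path_image P"
proof -
  let ?f = "\<lambda>m. trav m 0 0"
  have "summable (\<lambda>m. c * (1/2) ^ m)"
    by (intro summable_mult summable_geometric) auto
  moreover have "norm (?f (Suc m) t - ?f m t) \<le> c * (1/2) ^ m" if "t \<in> {0..1}" for m t
    using dist_trav_Suc[OF that, of m 0 0] by (simp only: dist_norm) (simp add: power_divide)
  \<comment> \<open>The M-test is applied to the telescoping series of differences; the initial term
    \<open>?f 0\<close> is added back afterwards.\<close>
  ultimately obtain g where "uniform_limit {0..1} (\<lambda>m t. \<Sum>i<m. ?f (Suc i) t - ?f i t) g sequentially"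
    using Weierstrass_m_test[of "{0..1}" "\<lambda>m t. ?f (Suc m) t - ?f m t" "\<lambda>m. c * (1/2) ^ m"] by blast
  then have "uniform_limit {0..1} (\<lambda>m t. ?f m t - ?f 0 t) g sequentially"
    by (simp only: sum_lessThan_telescope[of "\<lambda>m. trav m 0 0 _"])
  from uniform_limit_add[OF this uniform_limit_const, of "?f 0"]
  obtain P where P: "uniform_limit {0..1} ?f P sequentially"
    by (auto simp del: trav.simps)
  have "path P"
    unfolding path_def
    by (rule uniform_limit_theorem[OF _ P]) (use path_trav in \<open>auto simp: path_def\<close>)
  moreover have "path_image P \<subseteq> closure (B 0 0)"
  proof (clarsimp simp only: path_image_def)
    fix t :: real assume t: "t \<in> {0..1}"
    have "(\<lambda>m. ?f m t) \<longlonglongrightarrow> P t"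
      using tendsto_uniform_limitI[OF P t] .
    then show "P t \<in> closure (B 0 0)"
      using trav_in_B'[OF t] unfolding closure_sequential by (intro exI[of _ "\<lambda>m. ?f m t"]) blast
  qed
  moreover have "x \<in> path_image P"
    if x: "\<And>m. m \<ge> m0 \<Longrightarrow> x \<in> path_image (?f m)" for x m0
  proof -
    have "\<exists>y\<in>path_image P. dist y x < e" if "e > 0" for e
    proof -
      have "\<forall>\<^sub>F m in sequentially. \<forall>t\<in>{0..1}. dist (?f m t) (P t) < e"
        using uniform_limitD[OF P \<open>e > 0\<close>] .
      then obtain m1 where m1: "\<And>m. m \<ge> m1 \<Longrightarrow> \<forall>t\<in>{0..1}. dist (?f m t) (P t) < e"
        unfolding eventually_sequentially by blast
      obtain t where "t \<in> {0..1}" "x = ?f (max m0 m1) t"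
        using x[of "max m0 m1"] unfolding path_image_def by auto
      then show ?thesis
        using m1[of "max m0 m1"] by (intro bexI[of _ "P t"]) (auto simp: path_image_def dist_commute)
    qed
    then have "x \<in> closure (path_image P)"
      by (simp add: closure_approachable)
    then show ?thesis
      using closed_path_image[OF \<open>path P\<close>] by simp
  qed
  ultimately show ?thesis
    by (rule that)
qed

end

section \<open>The shark teeth\<close>

lemma tooth_bounds: "0 \<le> tooth t" "tooth t \<le> 1/2"
  using ceiling_diff_floor_le_1[of t] unfolding tooth_def by auto

lemma tooth_of_nat_add:
  assumes "0 \<le> s" "s \<le> 1"
  shows "tooth (real j + s) = min s (1 - s)"
proof (cases "s \<le> 1/2")
  case True
  then show ?thesis using tooth_up[of "real j + s" "int j"] assms by (simp add: min_def)
next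
  case False
  then show ?thesis using tooth_down[of "real j + s" "int j + 1"] assms by (simp add: min_def)
qed

text \<open>The parameter ranges over all reals because the dyadic cells used later also lie to the
  right of 1.\<close>

definition row_point :: "nat \<Rightarrow> real \<Rightarrow> real \<times> real" where
  "row_point k t = (t, 1 / real k * scaled_tooth (level k) t)"

lemma teeth_row_eq: "teeth_row k = row_point k ` {0..1}"
  by (simp add: teeth_row_def row_point_def)

text \<open>The tooth of row \<open>k\<close> over the \<open>j\<close>-th dyadic cell of its level,
  written without floor and ceiling so that continuity is immediate.\<close>

definition tooth_path :: "nat \<Rightarrow> nat \<Rightarrow> real \<Rightarrow> real \<times> real" where
  "tooth_path k j s = ((real j + s) / 2 ^ level k, min s (1 - s) / (real k * 2 ^ level k))"

lemma path_tooth_path: "path (tooth_path k j)"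
  unfolding path_def tooth_path_def
  \<comment> \<open>For \<open>k = 0\<close> division by zero makes the second coordinate constantly
    0; otherwise the denominator is nonzero.\<close>
  by (cases "k = 0") (auto intro!: continuous_intros)

lemma tooth_path_eq:
  assumes "s \<in> {0..1}"
  shows "tooth_path k j s = row_point k ((real j + s) / 2 ^ level k)"
  using assms by (simp add: tooth_path_def row_point_def scaled_tooth_def tooth_of_nat_add)

lemma path_image_tooth_path:
  "path_image (tooth_path k j) = row_point k ` {real j / 2 ^ level k .. real (Suc j) / 2 ^ level k}"
proof -
  have "path_image (tooth_path k j) = row_point k ` ((\<lambda>s. (real j + s) / 2 ^ level k) ` {0..1})"
    unfolding path_image_def image_image by (intro image_cong refl tooth_path_eq)
  also have "(\<lambda>s. (real j + s) / 2 ^ level k) ` {0..1} = {real j / 2 ^ level k .. real (Suc j) / 2 ^ level k}"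
  proof (intro equalityI subsetI)
    fix t assume "t \<in> {real j / 2 ^ level k .. real (Suc j) / 2 ^ level k}"
    then show "t \<in> (\<lambda>s. (real j + s) / 2 ^ level k) ` {0..1}"
      by (intro image_eqI[of _ _ "t * 2 ^ level k - real j"]) (auto simp: field_simps)
  qed (auto simp: field_simps)
  finally show ?thesis .
qed

text \<open>The bound by \<open>1 / (2 * real k)\<close> makes the rows sink to the base interval
  and puts the rows with \<open>k \<ge> 2\<close> below 1/4; the bound by
  \<open>1 / 2 ^ level k\<close> makes the loops as low as their cells are wide.\<close>

lemma row_point_bounds:
  "0 \<le> snd (row_point k t)" "snd (row_point k t) \<le> 1 / (2 * real k)"
  "k \<ge> 1 \<Longrightarrow> snd (row_point k t) \<le> 1 / 2 ^ level k"
proof -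
  have *: "0 \<le> scaled_tooth n t" "scaled_tooth n t \<le> 1/2" "scaled_tooth n t \<le> 1 / 2 ^ n" for n
  proof -
    show "0 \<le> scaled_tooth n t"
      by (simp add: scaled_tooth_def tooth_bounds)
    have "tooth (2 ^ n * t) / 2 ^ n \<le> (1/2) / 1"
      by (intro frac_le tooth_bounds) auto
    then show "scaled_tooth n t \<le> 1/2"
      by (simp add: scaled_tooth_def)
    have "tooth (2 ^ n * t) \<le> 1"
      using tooth_bounds(2)[of "2 ^ n * t"] by linarith
    then show "scaled_tooth n t \<le> 1 / 2 ^ n"
      by (simp add: scaled_tooth_def divide_right_mono)
  qed
  show "0 \<le> snd (row_point k t)"
    using * by (simp add: row_point_def)
  have "1 / real k * scaled_tooth (level k) t \<le> 1 / real k * (1/2)"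
    by (rule mult_left_mono[OF *(2)]) simp
  then show "snd (row_point k t) \<le> 1 / (2 * real k)"
    by (simp add: row_point_def)
  assume "k \<ge> 1"
  then have "1 / real k * scaled_tooth (level k) t \<le> 1 * scaled_tooth (level k) t"
    by (intro mult_right_mono *) auto
  then show "snd (row_point k t) \<le> 1 / 2 ^ level k"
    using *(3)[of "level k"] by (simp add: row_point_def)
qed

section \<open>Closedness of the space\<close>

lemma closed_teeth_row: "closed (teeth_row k)"
proof -
  \<comment> \<open>Finitely many cells cover \<open>{0..1}\<close>, so the row is a finite union of
    path images.\<close>
  have "{0..1} = (\<Union>j<2 ^ level k. {real j / 2 ^ level k .. real (Suc j) / 2 ^ level k})"
  proof (intro equalityI subsetI)
    fix t :: real assume t: "t \<in> {0..1}"
    \<comment> \<open>At \<open>t = 1\<close> the floor would give the index after the last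
      cell.\<close>
    define j where "j = (if t = 1 then 2 ^ level k - 1 else nat \<lfloor>2 ^ level k * t\<rfloor>)"
    have "j < 2 ^ level k \<and> real j \<le> 2 ^ level k * t \<and> 2 ^ level k * t \<le> real (Suc j)"
    proof (cases "t = 1")
      case True
      then show ?thesis by (simp add: j_def of_nat_diff)
    next
      case False
      then have "2 ^ level k * t < 2 ^ level k" "0 \<le> 2 ^ level k * t" using t by auto
      then have "\<lfloor>2 ^ level k * t\<rfloor> < 2 ^ level k" "0 \<le> \<lfloor>2 ^ level k * t\<rfloor>"
        by (simp_all add: floor_less_iff)
      then show ?thesis
        using False by (simp add: j_def nat_less_iff) linarith
    qed
    then show "t \<in> (\<Union>j<2 ^ level k. {real j / 2 ^ level k .. real (Suc j) / 2 ^ level k})"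
      by (intro UN_I[of j]) (auto simp: field_simps)
  next
    fix t assume "t \<in> (\<Union>j<2 ^ level k. {real j / 2 ^ level k .. real (Suc j) / 2 ^ level k})"
    then obtain j where j: "Suc j \<le> 2 ^ level k" "real j / 2 ^ level k \<le> t" "t \<le> real (Suc j) / 2 ^ level k"
      unfolding UN_iff lessThan_iff atLeastAtMost_iff Suc_le_eq by blast
    have "real (Suc j) \<le> 2 ^ level k"
      using j(1) by (metis of_nat_le_iff of_nat_numeral of_nat_power)
    then have "real (Suc j) / 2 ^ level k \<le> 1"
      by simp
    moreover have "0 \<le> real j / 2 ^ level k" by simp
    ultimately show "t \<in> {0..1}"
      using j(2,3) unfolding atLeastAtMost_iff by linarith
  qed
  then have "teeth_row k = (\<Union>j<2 ^ level k. path_image (tooth_path k j))"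
    by (simp add: teeth_row_eq path_image_tooth_path image_UN)
  then show ?thesis
    by (simp add: closed_UN closed_path_image path_tooth_path)
qed

text \<open>All rows beyond \<open>N\<close> lie in a box of height \<open>1 / N\<close>. Replacing
  them by that box gives a closed set for each \<open>N\<close>, and these closed sets intersect in
  exactly the space.\<close>

lemma closed_shark_teeth: "closed shark_teeth"
proof -
  have "shark_teeth = (\<Inter>N\<in>{1..}. {0..1} \<times> {0} \<union> (\<Union>k\<in>{1..N}. teeth_row k) \<union> {0..1} \<times> {0..1 / real N})"
    (is "_ = (\<Inter>N\<in>_. ?C N)")
  proof (intro equalityI subsetI INT_I)
    fix p and N :: nat assume p: "p \<in> shark_teeth" and "N \<in> {1..}"
    then have N: "N \<ge> 1" by simp
    show "p \<in> ?C N"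
    proof (cases "p \<in> {0..1} \<times> {0} \<union> (\<Union>k\<in>{1..N}. teeth_row k)")
      case False
      then obtain k where row: "k \<ge> 1" "p \<in> teeth_row k"
        using p unfolding shark_teeth_def by blast
      then have "k \<notin> {1..N}"
        using False by blast
      with row obtain t where k: "k > N" "t \<in> {0..1}" "p = row_point k t"
        unfolding teeth_row_eq by auto
      have "1 / (2 * real k) \<le> 1 / real N"
        using k N by (intro frac_le) auto
      then show ?thesis
        using row_point_bounds(1,2)[of k t] k by (auto simp: row_point_def)
    qed auto
  next
    fix p assume p: "p \<in> (\<Inter>N\<in>{1..}. ?C N)"
    show "p \<in> shark_teeth"
    proof (cases "snd p > 0")
      case True
      \<comment> \<open>For this \<open>N\<close> the point is above the box, so it must lie on one
        of the first \<open>N\<close> rows.\<close>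
      then obtain N where N: "N \<ge> 1" "1 / real N < snd p"
        by (metis One_nat_def Suc_leI inverse_eq_divide real_arch_inverse gr0I)
      then have "p \<in> ?C N" using p by auto
      then show ?thesis
        using N True by (auto simp: shark_teeth_def)
    next
      case False
      have "p \<in> ?C 1" using p by blast
      then have "p \<in> {0..1} \<times> {0..1} \<or> p \<in> teeth_row 1"
        by auto
      moreover have "0 \<le> snd p \<and> fst p \<in> {0..1}" if "p \<in> teeth_row 1"
        using that row_point_bounds(1)[of 1] unfolding teeth_row_eq by (auto simp: row_point_def)
      ultimately have "p \<in> {0..1} \<times> {0}"
        using False unfolding mem_Times_iff by auto
      then show ?thesis
        unfolding shark_teeth_def by blast
    qed
  qed
  moreover have "closed (\<Inter>N\<in>{1..}. ?C N)"
    by (intro closed_INT ballI closed_Un closed_UN closed_Times) (auto simp: closed_teeth_row)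
  ultimately show ?thesis
    by (rule ssubst)
qed

text \<open>\<open>level k = n\<close> forces \<open>k + 1 < 2 powr (2 powr (n + 1))\<close>. Hence
  one loop over a dyadic cell of depth \<open>n\<close> has only finitely many teeth to
  visit.\<close>

lemma finite_level: "finite {k. k \<ge> 2 \<and> level k = n}"
proof (rule finite_subset)
  show "{k. k \<ge> 2 \<and> level k = n} \<subseteq> {..nat \<lceil>2 powr (2 powr (real n + 1))\<rceil>}"
  proof clarsimp
    fix k :: nat assume k: "k \<ge> 2" "n = level k"
    have "log 2 (real k + 1) \<ge> 1" using k by simp
    moreover have "log 2 (log 2 (real k + 1)) < real (level k) + 1"
      using int_level[of k] k by linarith
    ultimately have "log 2 (real k + 1) < 2 powr (real (level k) + 1)"
      by (subst (asm) log_less_iff) auto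
    then have "real k + 1 < 2 powr (2 powr (real (level k) + 1))"
      by (subst (asm) log_less_iff) auto
    then show "k \<le> nat \<lceil>2 powr (2 powr (real (level k) + 1))\<rceil>"
      by linarith
  qed
qed simp

section \<open>A path onto the base interval and all rows but the first\<close>

lemma path_through_lower_teeth:
  obtains P where "path P" "path_image P \<subseteq> shark_teeth" "\<And>p. p \<in> path_image P \<Longrightarrow> snd p \<le> 1/4"
    "shark_teeth \<subseteq> path_image P \<union> teeth_row 1"
proof -
  define v :: "nat \<Rightarrow> nat \<Rightarrow> real \<times> real" where "v = (\<lambda>n j. (real j / 2 ^ n, 0))"
  define J :: "nat \<Rightarrow> nat \<Rightarrow> real set" where "J = (\<lambda>n j. {real j / 2 ^ n .. real (Suc j) / 2 ^ n})"
  define K where "K = (\<lambda>n. {k. k \<ge> 2 \<and> level k = n})"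
  \<comment> \<open>The box makes the region small; the second factor confines it to the base line
    and the rows from 2 on.\<close>
  define B :: "nat \<Rightarrow> nat \<Rightarrow> (real \<times> real) set" where "B = (\<lambda>n j. J n j \<times> {0..1 / 2 ^ n} \<inter>
     (UNIV \<times> {0} \<union> (\<Union>k\<in>{2..}. row_point k ` UNIV)))"
  have seg: "closed_segment (v n j) (v n (Suc j)) = J n j \<times> {0}" for n j
  proof -
    have "closed_segment (v n j) (v n (Suc j)) =
        (\<lambda>x. (x, 0)) ` closed_segment (real j / 2 ^ n) (real (Suc j) / 2 ^ n)"
      unfolding v_def
      by (rule closed_segment_linear_image[of "\<lambda>x. (x, 0)"]) (auto intro!: linearI)
    then show ?thesis
      by (auto simp: J_def closed_segment_eq_real_ivl divide_right_mono)
  qed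
  have "\<exists>p. path p \<and> pathstart p = v n j \<and> pathfinish p = v n j \<and>
      path_image p = J n j \<times> {0} \<union> (\<Union>k\<in>K n. row_point k ` J n j)" for n j
  proof -
    \<comment> \<open>Index 0, which is not in \<open>K n\<close>, stands for the base segment of
      the cell.\<close>
    define g where "g k = (if k = 0 then linepath (v n j) (v n (Suc j)) else tooth_path k j)" for k
    have im: "path_image (g k) = row_point k ` J n j" if "k \<in> K n" for k
      using that by (auto simp: g_def K_def path_image_tooth_path J_def)
    have "path (g i) \<and> pathstart (g i) = v n j" if "i \<in> insert 0 (K n)" for i
      using that path_tooth_path[of i j]
      by (cases "i = 0") (auto simp: g_def K_def pathstart_def tooth_path_def v_def linepath_0')
    then obtain p where "path p \<and> pathstart p = v n j \<and> pathfinish p = v n j \<and>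
        path_image p = insert (v n j) (\<Union>i\<in>insert 0 (K n). path_image (g i))"
      using loop_through_paths[of "insert 0 (K n)" g "v n j"] finite_level by (auto simp: K_def)
    moreover have "path_image (g 0) = J n j \<times> {0}" "v n j \<in> J n j \<times> {0}"
      by (auto simp: g_def seg) (auto simp: v_def J_def divide_right_mono)
    ultimately show ?thesis
      using im by (intro exI[of _ p]) auto
  qed
  then obtain L where loop: "\<And>n j. path (L n j)" "\<And>n j. pathstart (L n j) = v n j"
      "\<And>n j. pathfinish (L n j) = v n j"
      "\<And>n j. path_image (L n j) = J n j \<times> {0} \<union> (\<Union>k\<in>K n. row_point k ` J n j)"
    by metis
  have J_refine: "J n j = J (Suc n) (2 * j) \<union> J (Suc n) (Suc (2 * j))" for n j
    by (auto simp: J_def field_simps)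
  \<comment> \<open>The constant 2 accounts for the width and the height of the box, each at most
    \<open>1 / 2 ^ n\<close>.\<close>
  interpret dyadic_loops v B L 2
  proof
    show "v (Suc n) (2 * j) = v n j" for n j
      by (simp add: v_def)
    have "row_point k ` J n j \<subseteq> B n j" if "k \<in> K n" for k n j
      using that row_point_bounds(1,3)[of k] by (auto simp: B_def K_def row_point_def)
    then show "path_image (L n j) \<subseteq> B n j" for n j
      unfolding loop(4) by (intro Un_least UN_least) (auto simp: B_def)
    show "closed_segment (v n j) (v n (Suc j)) \<subseteq> B n j" for n j
      unfolding seg by (auto simp: B_def)
    have "1 / 2 ^ Suc n \<le> (1::real) / 2 ^ n" for n
      by (simp add: field_simps)
    then show "B (Suc n) (2 * j) \<subseteq> B n j" "B (Suc n) (Suc (2 * j)) \<subseteq> B n j" for n j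
      unfolding B_def J_refine[of n j] by (force intro: order_trans)+
    show "dist x y \<le> 2 / 2 ^ n" if "x \<in> B n j" "y \<in> B n j" for x y n j
    proof -
      have J: "\<bar>s - t\<bar> \<le> 1 / 2 ^ n" if "s \<in> J n j" "t \<in> J n j" for s t
        using that by (auto simp: J_def add_divide_distrib abs_le_iff)
      have "dist x y \<le> \<bar>fst x - fst y\<bar> + \<bar>snd x - snd y\<bar>"
        by (metis dist_prod_def dist_real_def sqrt_sum_squares_le_sum_abs abs_abs)
      also have "\<dots> \<le> 1 / 2 ^ n + 1 / 2 ^ n"
      proof (intro add_mono)
        have "x \<in> J n j \<times> {0..1 / 2 ^ n}" "y \<in> J n j \<times> {0..1 / 2 ^ n}"
          using that unfolding B_def by blast+
        then have xy: "fst x \<in> J n j" "fst y \<in> J n j"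
            "snd x \<in> {0..1 / 2 ^ n}" "snd y \<in> {0..1 / 2 ^ n}"
          unfolding mem_Times_iff by auto
        show "\<bar>fst x - fst y\<bar> \<le> 1 / 2 ^ n"
          using xy by (intro J)
        from xy(3,4) show "\<bar>snd x - snd y\<bar> \<le> 1 / 2 ^ n"
          unfolding atLeastAtMost_iff by linarith
      qed
      finally show ?thesis by simp
    qed
  qed (use loop in auto)
  \<comment> \<open>Descend \<open>d\<close> generations, each time to a child whose cell contains
    \<open>t\<close>; the loop reached there visits row \<open>k\<close>, and \<open>m > d\<close>
    ensures that the traversal includes it.\<close>
  have teeth: "row_point k t \<in> path_image (trav m n j)"
    if "k \<ge> 2" "level k = n + d" "m > d" "t \<in> J n j" for k t m n j d
    using that
  proof (induction d arbitrary: m n j)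
    case 0
    then obtain m' where "m = Suc m'" by (cases m) auto
    then show ?case
      using 0 unfolding \<open>m = Suc m'\<close> path_image_trav_Suc loop(4) by (auto simp: K_def)
  next
    case (Suc d)
    then obtain m' where m': "m = Suc m'" "m' > d" by (cases m) auto
    show ?case
      unfolding m'(1) path_image_trav_Suc
      using Suc.IH[of "Suc n" m'] Suc.prems m'(2) J_refine[of n j] by auto
  qed
  obtain P where P: "path P" "path_image P \<subseteq> closure (B 0 0)"
      "\<And>x m0. (\<And>m. m \<ge> m0 \<Longrightarrow> x \<in> path_image (trav m 0 0)) \<Longrightarrow> x \<in> path_image P"
    using limit_path by blast
  have B0: "B 0 0 \<subseteq> shark_teeth \<inter> UNIV \<times> {..1/4}"
  proof
    fix p assume p: "p \<in> B 0 0"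
    then have "p \<in> J 0 0 \<times> {0..1 / 2 ^ 0}" unfolding B_def by blast
    then have "fst p \<in> {0..1}" by (auto simp: J_def)
    consider "snd p = 0" | k where "k \<ge> 2" "p = row_point k (fst p)"
      using p by (auto simp: B_def row_point_def)
    then show "p \<in> shark_teeth \<inter> UNIV \<times> {..1/4}"
    proof cases
      case 1
      then show ?thesis
        using \<open>fst p \<in> {0..1}\<close> by (cases p) (auto simp: shark_teeth_def)
    next
      case 2
      have "snd p \<le> 1 / (2 * real k)" using row_point_bounds(2) 2 by metis
      also have "\<dots> \<le> 1/4" using 2 by (simp add: field_simps)
      finally have "snd p \<le> 1/4" .
      moreover have "p \<in> teeth_row k" unfolding teeth_row_eq using 2 \<open>fst p \<in> {0..1}\<close> by blast
      ultimately show ?thesis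
        using 2(1) by (cases p) (auto simp: shark_teeth_def)
    qed
  qed
  \<comment> \<open>The limit path is known only to stay in the closure of \<open>B 0 0\<close>;
    closedness brings it back into the space and keeps the height bound.\<close>
  have "closed (shark_teeth \<inter> UNIV \<times> {..1/4})"
    by (intro closed_Int closed_shark_teeth closed_Times) auto
  then have sub: "path_image P \<subseteq> shark_teeth \<inter> UNIV \<times> {..1/4}"
    using P(2) B0 closure_minimal by blast
  have "p \<in> path_image P" if p: "p \<in> {0..1} \<times> {0}" for p
  proof (rule P(3))
    fix m :: nat assume "m \<ge> 1"
    then obtain m' where "m = Suc m'" by (cases m) auto
    then show "p \<in> path_image (trav m 0 0)"
      unfolding \<open>m = Suc m'\<close> path_image_trav_Suc loop(4) using p by (auto simp: J_def)
  qed
  \<comment> \<open>From \<open>Suc (level k)\<close> generations on, every traversal from the root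
    contains the loops of depth \<open>level k\<close>.\<close>
  moreover have "p \<in> path_image P" if "k \<ge> 2" "p \<in> teeth_row k" for p k
    using that teeth[of k 0 "level k" _ _ 0] unfolding teeth_row_eq
    by (intro P(3)[of "Suc (level k)"]) (auto simp: J_def)
  moreover have "k = 1 \<or> k \<ge> 2" if "k \<ge> 1" for k :: nat
    using that by linarith
  ultimately have "shark_teeth \<subseteq> path_image P \<union> teeth_row 1"
    unfolding shark_teeth_def by blast
  moreover have "snd p \<le> 1/4" if "p \<in> path_image P" for p
    using that sub by auto
  ultimately show ?thesis
    using that[of P] P(1) sub by blast
qed

section \<open>The generating maps and their contraction\<close>

theorem theorem1: "topological_IFS_attractor (top_of_set shark_teeth)"
proof -
  obtain P where P: "path P" "path_image P \<subseteq> shark_teeth"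
      "\<And>p. p \<in> path_image P \<Longrightarrow> snd p \<le> 1/4" "shark_teeth \<subseteq> path_image P \<union> teeth_row 1"
    using path_through_lower_teeth by blast
  \<comment> \<open>\<open>q\<close> vanishes up to height 1/4, hence on the image of
    \<open>P\<close>, and reaches 1 at height 1/2, the tip of the first row.\<close>
  define q :: "real \<times> real \<Rightarrow> real" where "q = (\<lambda>p. max 0 (4 * snd p - 1))"
  \<comment> \<open>A piece over a cell of width 1/8 changes height at rate at most 1/8, and
    \<open>q\<close> multiplies this by at most 4, which gives the factor 1/2.\<close>
  define A where "A = (\<lambda>i s. let t = (real i + s) / 8 in (t, min t (1 - t)))"
  have "level 1 = 0"
    by (simp add: level_def)
  then have row1: "row_point 1 t = (t, min t (1 - t))" if "t \<in> {0..1}" for t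
    using that tooth_of_nat_add[of t 0] by (simp add: row_point_def scaled_tooth_def)
  have A_row: "A i s = row_point 1 ((real i + s) / 8)" if "i < 8" "s \<in> {0..1}" for i s
    using that by (subst row1) (auto simp: A_def Let_def)
  have A_image: "(\<Union>i<8. A i ` {0..1}) = teeth_row 1"
  proof (intro equalityI subsetI)
    fix p assume "p \<in> teeth_row 1"
    then obtain t where t: "t \<in> {0..1}" "p = row_point 1 t"
      by (auto simp: teeth_row_eq)
    define i where "i = (if t = 1 then 7 else nat \<lfloor>8 * t\<rfloor>)"
    have "i < 8" "8 * t - real i \<in> {0..1}"
      using t(1) unfolding i_def by (auto split: if_splits) linarith+
    then show "p \<in> (\<Union>i<8. A i ` {0..1})"
      using t(2) A_row[of i "8 * t - real i"] 
      by (intro UN_I[of i] image_eqI[of _ _ "8 * t - real i"]) auto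
  qed (auto simp: A_row teeth_row_eq)
  have row1_sub: "teeth_row 1 \<subseteq> shark_teeth"
    by (auto simp: shark_teeth_def)
  show ?thesis
  proof (rule attractor_through_interval[where H = "insert P (A ` {..<8})" and q = q])
    show "continuous_on {0..1} h" if "h \<in> insert P (A ` {..<8})" for h
      using that P(1) by (auto simp: path_def A_def Let_def intro!: continuous_intros)
    have "(\<Union>h\<in>insert P (A ` {..<8}). h ` {0..1}) = path_image P \<union> (\<Union>i<8. A i ` {0..1})"
      by (simp add: path_image_def)
    then show "(\<Union>h\<in>insert P (A ` {..<8}). h ` {0..1}) = shark_teeth"
      using P(2,4) A_image row1_sub by auto
    show "continuous_on shark_teeth q"
      unfolding q_def by (intro continuous_intros)
    have "q p \<in> {0..1}" if p: "p \<in> shark_teeth" for p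
    proof -
      have "snd p \<le> 1/2"
      proof (cases "p \<in> path_image P")
        case True
        then show ?thesis using P(3)[of p] by simp
      next
        case False
        then obtain t where "p = row_point 1 t"
          using p P(4) unfolding teeth_row_eq by blast
        then show ?thesis using row_point_bounds(2)[of 1 t] by simp
      qed
      then show ?thesis by (auto simp: q_def)
    qed
    moreover have "u \<in> q ` shark_teeth" if "u \<in> {0..1}" for u
    proof (rule image_eqI)
      \<comment> \<open>The preimage lies on the rising side of the first tooth, at height
        \<open>(1 + u) / 4\<close>.\<close>
      show "u = q (row_point 1 ((1 + u) / 4))"
        using that by (subst row1) (auto simp: q_def min_def max_def field_simps)
      show "row_point 1 ((1 + u) / 4) \<in> shark_teeth"
        using that row1_sub by (auto simp: teeth_row_eq)
    qed
    ultimately show "q ` shark_teeth = {0..1}"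
      by blast
    fix h and s t :: real assume h: "h \<in> insert P (A ` {..<8})" and st: "s \<in> {0..1}" "t \<in> {0..1}"
    show "dist (q (h s)) (q (h t)) \<le> dist s t / 2"
    proof (cases "h = P")
      case True
      have "q (P r) = 0" if "r \<in> {0..1}" for r
        using P(3)[of "P r"] that by (simp add: q_def path_image_def)
      then show ?thesis using st True by simp
    next
      case False
      then obtain i where i: "h = A i" using h by auto
      have lip: "\<bar>max 0 (4 * min x (1 - x) - 1) - max 0 (4 * min y (1 - y) - 1)\<bar> \<le> 4 * \<bar>x - y\<bar>"
        for x y :: real
      proof -
        have "\<bar>min x (1 - x) - min y (1 - y)\<bar> \<le> \<bar>x - y\<bar>"
          by linarith
        moreover have "\<bar>max 0 (4 * a - 1) - max 0 (4 * b - 1)\<bar> \<le> 4 * \<bar>a - b\<bar>" for a b :: real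
          by (auto simp: max_def abs_if)
        ultimately show ?thesis
          by (meson order_trans mult_left_mono zero_le_numeral)
      qed
      show ?thesis
        using lip[of "(real i + s) / 8" "(real i + t) / 8"]
        by (simp add: i q_def A_def Let_def dist_real_def diff_divide_distrib[symmetric])
    qed
  qed simp
qed

end
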